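(* Let $d\ge1$, $c>0$ and $0<\alpha<2$. There is a constant $c_{c,d,\alpha}>0$ depending only on $c$, $d$ and $\alpha$ such that the following holds. Let $\Gamma$ be the complete graph with $d+1$ vertices and let $\rho:[0,\infty)\to[0,1]$ be nonincreasing with $\rho(s)\ge c\,s^{-\alpha}$ for all $s\ge1$. Let $u:\Gamma\times J\to\mathbf{R}$, where $J\subset\mathbf{R}$ is an interval, be a solution, differentiable in $t$, of $$\partial_t u(v,t)=\frac1d\sum_{\tilde v\ne v}[u(\tilde v,t)-u(v,t)]\,\rho(|u(\tilde v,t)-u(v,t)|).$$ Then for $t\in J$: (1) $\frac{d}{dt}\left(\mathrm{Var}_{u(\cdot,t)}^{\frac\alpha2}\right)\le-c_{c,d,\alpha}$ if $1\le\mathrm{Var}_{u(\cdot,t)}$; (2) $\frac{d}{dt}\log\mathrm{Var}_{u(\cdot,t)}\le-c_{c,d,\alpha}$ if $0<\mathrm{Var}_{u(\cdot,t)}<1$.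
   Context: For $w:\Gamma\to\mathbf{R}$, $\mathcal{A}_w=\frac1{d+1}\sum_{v}w(v)$ and $\mathrm{Var}_w=\frac{1}{d+1}\sum_v|w(v)-\mathcal{A}_w|^2$. Time is continuous. *)

theory Defs
  imports "HOL-Analysis.Analysis"
begin

text \<open>The vertices of the complete graph with \<open>d + 1\<close> vertices are \<open>0, \<dots>, d\<close>.\<close>

definition average :: "nat \<Rightarrow> (nat \<Rightarrow> real) \<Rightarrow> real" where
  "average d w = 1 / (real d + 1) * (\<Sum>v\<le>d. w v)"

definition variance :: "nat \<Rightarrow> (nat \<Rightarrow> real) \<Rightarrow> real" where
  "variance d w = 1 / (real d + 1) * (\<Sum>v\<le>d. \<bar>w v - average d w\<bar>\<^sup>2)"

text \<open>Derivatives in time are taken within \<open>J\<close>, hence are one-sided at an endpoint of \<open>J\<close>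
  that belongs to \<open>J\<close>.\<close>

definition solution_on ::
  "nat \<Rightarrow> (real \<Rightarrow> real) \<Rightarrow> real set \<Rightarrow> (nat \<Rightarrow> real \<Rightarrow> real) \<Rightarrow> bool" where
  "solution_on d \<rho> J u \<longleftrightarrow>
     (\<forall>t\<in>J. \<forall>v\<le>d.
        ((\<lambda>s. u v s) has_real_derivative
           (1 / real d * (\<Sum>v'\<in>{..d} - {v}. (u v' t - u v t) * \<rho> \<bar>u v' t - u v t\<bar>)))
        (at t within J))"

end

theory Submission
  imports Defs
begin

text \<open>Testing the equation against \<open>u - \<A>\<close> and symmetrising over pairs of vertices gives
  \<open>Var' = - 1/(d(d+1)) \<Sum> (u(v') - u(v))\<^sup>2 \<rho>(|u(v') - u(v)|)\<close>, summed over all ordered pairs.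
  Only the pair with the largest difference \<open>M\<close> is kept: the sum is at least \<open>M\<^sup>2 \<rho>(M)\<close>, while
  \<open>Var \<le> M\<^sup>2 \<le> 4 (d+1) Var\<close>. If \<open>Var \<ge> 1\<close>, then
  \<open>M\<^sup>2 \<rho>(M) \<ge> c M\<^bsup>2-\<alpha>\<^esup> \<ge> c Var\<^bsup>1-\<alpha>/2\<^esup>\<close>; if \<open>Var < 1\<close>, then \<open>M\<close> is bounded, so \<open>\<rho>(M)\<close>
  is bounded below.\<close>

text \<open>Renaming the two summation indices flips the sign of \<open>k\<close>, so the sums
  weighted by \<open>f x\<close> and by \<open>f y\<close> are negatives of each other. This is the
  symmetrisation over pairs of vertices.\<close>

lemma sum_antisym_weighted:
  fixes f :: "'a \<Rightarrow> real"
  assumes "\<And>x y. k y x = - k x y"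
  shows "2 * (\<Sum>x\<in>A. \<Sum>y\<in>A. f x * k x y) = - (\<Sum>x\<in>A. \<Sum>y\<in>A. (f y - f x) * k x y)"
proof -
  have "(\<Sum>x\<in>A. \<Sum>y\<in>A. f y * k x y) = (\<Sum>x\<in>A. \<Sum>y\<in>A. f x * k y x)"
    by (rule sum.swap)
  also have "\<dots> = - (\<Sum>x\<in>A. \<Sum>y\<in>A. f x * k x y)"
    unfolding sum_negf[symmetric]
    by (intro sum.cong refl) (metis assms mult_minus_right)
  finally show ?thesis
    by (simp add: left_diff_distrib sum_subtractf)
qed

lemma diff_average: "w p - average d w = (1 / (real d + 1)) * (\<Sum>v\<le>d. w p - w v)"
  by (simp add: average_def sum_subtractf field_simps)

lemma has_real_derivative_average:
  assumes "\<And>v. v \<le> d \<Longrightarrow> (u v has_real_derivative u' v) (at t within J)"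
  shows "((\<lambda>s. average d (\<lambda>v. u v s)) has_real_derivative average d u') (at t within J)"
  unfolding average_def using assms by (intro DERIV_cmult DERIV_sum) auto

text \<open>The zero mean of \<open>u'\<close> makes the average stationary at \<open>t\<close>, so
  the moving centre contributes nothing when the squares are differentiated.\<close>

lemma has_real_derivative_variance:
  assumes "\<And>v. v \<le> d \<Longrightarrow> (u v has_real_derivative u' v) (at t within J)"
    and "average d u' = 0"
  shows "((\<lambda>s. variance d (\<lambda>v. u v s)) has_real_derivative
    2 / (real d + 1) * (\<Sum>v\<le>d. (u v t - average d (\<lambda>v. u v t)) * u' v)) (at t within J)"
proof -
  have "((\<lambda>s. (u v s - average d (\<lambda>v. u v s))\<^sup>2) has_real_derivative
      2 * ((u v t - average d (\<lambda>v. u v t)) * u' v)) (at t within J)" if "v \<le> d" for v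
    using that
    by (auto intro!: derivative_eq_intros assms(1) has_real_derivative_average[where u' = u']
        simp: assms(2))
  then have "((\<lambda>s. \<Sum>v\<le>d. (u v s - average d (\<lambda>v. u v s))\<^sup>2) has_real_derivative
      (\<Sum>v\<le>d. 2 * ((u v t - average d (\<lambda>v. u v t)) * u' v))) (at t within J)"
    by (intro DERIV_sum) auto
  from DERIV_cmult[OF this, of "1 / (real d + 1)"] show ?thesis
    unfolding variance_def power2_abs by (simp add: sum_distrib_left[symmetric])
qed

lemma solution_on_variance:
  assumes "solution_on d \<rho> J u" and "t \<in> J"
  shows "((\<lambda>s. variance d (\<lambda>v. u v s)) has_real_derivative
    - (1 / ((real d + 1) * real d)) *
      (\<Sum>v\<le>d. \<Sum>v'\<le>d. (u v' t - u v t)\<^sup>2 * \<rho> \<bar>u v' t - u v t\<bar>)) (at t within J)"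
proof -
  \<comment> \<open>\<open>k v v'\<close> is the pull of \<open>v'\<close> on \<open>v\<close>;
    action and reaction are opposite.\<close>
  define k where "k v v' = (u v' t - u v t) * \<rho> \<bar>u v' t - u v t\<bar>" for v v'
  define u' where "u' v = 1 / real d * (\<Sum>v'\<le>d. k v v')" for v
  define a where "a = average d (\<lambda>v. u v t)"
  have antisym: "k y x = - k x y" for x y
    by (simp add: k_def abs_minus_commute algebra_simps)
  \<comment> \<open>The diagonal term \<open>k v v\<close> vanishes, so the sum may run over all
    vertices.\<close>
  have "(\<Sum>v'\<in>{..d} - {v}. k v v') = (\<Sum>v'\<le>d. k v v')" for v
    by (rule sum.mono_neutral_left) (auto simp: k_def)
  moreover have "(u v has_real_derivative 1 / real d * (\<Sum>v'\<in>{..d} - {v}. k v v')) (at t within J)"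
    if "v \<le> d" for v
    using assms that unfolding solution_on_def k_def by blast
  ultimately have deriv: "(u v has_real_derivative u' v) (at t within J)" if "v \<le> d" for v
    using that by (simp add: u'_def)
  \<comment> \<open>Symmetrisation with constant weight 1: the total pull is zero, which conserves
    the average.\<close>
  have "(\<Sum>v\<le>d. \<Sum>v'\<le>d. k v v') = 0"
    using sum_antisym_weighted[of k "\<lambda>_. 1" "{..d}", OF antisym] by simp
  then have "average d u' = 0"
    by (simp add: average_def u'_def sum_divide_distrib[symmetric])
  note D = has_real_derivative_variance[OF deriv this]
  have "2 * (\<Sum>v\<le>d. (u v t - a) * u' v) = 1 / real d * (2 * (\<Sum>v\<le>d. \<Sum>v'\<le>d. (u v t - a) * k v v'))"
    by (simp add: u'_def sum_distrib_left sum_divide_distrib diff_divide_distrib algebra_simps)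
  \<comment> \<open>Symmetrisation with weight \<open>u v t - a\<close>; the average
    \<open>a\<close> cancels in the differences.\<close>
  also have "\<dots> = - (1 / real d) * (\<Sum>v\<le>d. \<Sum>v'\<le>d. (u v' t - u v t) * k v v')"
    by (subst sum_antisym_weighted[of k, OF antisym]) simp
  finally have "2 / (real d + 1) * (\<Sum>v\<le>d. (u v t - a) * u' v) =
      - (1 / ((real d + 1) * real d)) * (\<Sum>v\<le>d. \<Sum>v'\<le>d. (u v' t - u v t) * k v v')"
    by (simp add: field_simps)
  with D show ?thesis
    by (simp add: a_def k_def power2_eq_square mult.assoc)
qed

text \<open>Each deviation from the average is a mean of differences between values, hence at most
  \<open>M\<close> in absolute value, and the variance is the mean of the squared
  deviations.\<close>

lemma variance_le_diameter_sq:
  assumes "\<And>v v'. v \<le> d \<Longrightarrow> v' \<le> d \<Longrightarrow> \<bar>w v' - w v\<bar> \<le> M"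
  shows "variance d w \<le> M\<^sup>2"
proof -
  have "\<bar>w v - average d w\<bar> \<le> M" if "v \<le> d" for v
  proof -
    have "\<bar>\<Sum>v'\<le>d. w v - w v'\<bar> \<le> (\<Sum>v'\<le>d. \<bar>w v - w v'\<bar>)"
      by (rule sum_abs)
    also have "\<dots> \<le> (\<Sum>v'\<le>d. M)"
      using assms that by (intro sum_mono) auto
    finally show ?thesis
      by (simp add: diff_average abs_mult field_simps)
  qed
  then have "(\<Sum>v\<le>d. \<bar>w v - average d w\<bar>\<^sup>2) \<le> (\<Sum>v\<le>d. M\<^sup>2)"
    by (intro sum_mono power_mono) auto
  then show ?thesis
    by (simp add: variance_def field_simps)
qed

text \<open>A single squared deviation is one term of a nonnegative sum equal to
  \<open>(real d + 1) * variance d w\<close>; the factor 4 comes from (x - y)^2 \<le> 2 x^2 + 2 y^2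
  applied to two deviations.\<close>

lemma diff_sq_le_variance:
  assumes "p \<le> d" and "q \<le> d"
  shows "(w p - w q)\<^sup>2 \<le> 4 * (real d + 1) * variance d w"
proof -
  define a where "a = average d w"
  have *: "(w v - a)\<^sup>2 \<le> (real d + 1) * variance d w" if "v \<le> d" for v
  proof -
    have "(w v - a)\<^sup>2 \<le> (\<Sum>v\<le>d. (w v - a)\<^sup>2)"
      using that by (intro member_le_sum) auto
    then show ?thesis
      by (simp add: variance_def a_def)
  qed
  have "(w p - w q)\<^sup>2 \<le> 2 * (w p - a)\<^sup>2 + 2 * (w q - a)\<^sup>2"
    using zero_le_power2[of "w p + w q - 2 * a"] by (simp add: power2_eq_square algebra_simps)
  with *[OF assms(1)] *[OF assms(2)] show ?thesis
    by linarith
qed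

lemma dissipation_ge_diameter:
  fixes w :: "nat \<Rightarrow> real"
  assumes "\<rho> ` {0..} \<subseteq> {0..1}"
  obtains M where "0 \<le> M" "variance d w \<le> M\<^sup>2" "M\<^sup>2 \<le> 4 * (real d + 1) * variance d w"
    "M\<^sup>2 * \<rho> M \<le> (\<Sum>v\<le>d. \<Sum>v'\<le>d. (w v' - w v)\<^sup>2 * \<rho> \<bar>w v' - w v\<bar>)"
proof -
  define S where "S = (\<lambda>(v, v'). \<bar>w v' - w v\<bar>) ` ({..d} \<times> {..d})"
  have fin: "finite S" "S \<noteq> {}"
    by (auto simp: S_def)
  have "\<exists>p\<le>d. \<exists>q\<le>d. x = \<bar>w q - w p\<bar>" if "x \<in> S" for x
    using that by (auto simp: S_def)
  then obtain p q where pq: "p \<le> d" "q \<le> d" "Max S = \<bar>w q - w p\<bar>"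
    using Max_in[OF fin] by blast
  have bound: "\<bar>w v' - w v\<bar> \<le> Max S" if "v \<le> d" "v' \<le> d" for v v'
    using that fin by (intro Max_ge) (auto simp: S_def image_iff)
  have nonneg: "0 \<le> (w v' - w v)\<^sup>2 * \<rho> \<bar>w v' - w v\<bar>" for v v'
    using assms by (intro mult_nonneg_nonneg) (auto simp: image_subset_iff)
  have "(w q - w p)\<^sup>2 * \<rho> \<bar>w q - w p\<bar> \<le> (\<Sum>v'\<le>d. (w v' - w p)\<^sup>2 * \<rho> \<bar>w v' - w p\<bar>)"
    using pq nonneg by (intro member_le_sum[of q _ "\<lambda>v'. (w v' - w p)\<^sup>2 * \<rho> \<bar>w v' - w p\<bar>"]) auto
  also have "\<dots> \<le> (\<Sum>v\<le>d. \<Sum>v'\<le>d. (w v' - w v)\<^sup>2 * \<rho> \<bar>w v' - w v\<bar>)"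
    using pq nonneg
    by (intro member_le_sum[of p _ "\<lambda>v. \<Sum>v'\<le>d. (w v' - w v)\<^sup>2 * \<rho> \<bar>w v' - w v\<bar>"])
      (auto intro: sum_nonneg)
  finally show ?thesis
    using pq variance_le_diameter_sq[OF bound] diff_sq_le_variance[of q d p w]
    by (intro that[of "Max S"]) auto
qed

lemma dissipation_ge_variance_powr:
  fixes w :: "nat \<Rightarrow> real"
  assumes "\<rho> ` {0..} \<subseteq> {0..1}" and "\<forall>s\<ge>1. \<rho> s \<ge> c * s powr (- \<alpha>)"
    and "c > 0" and "\<alpha> < 2" and "1 \<le> variance d w"
  shows "c * variance d w powr (1 - \<alpha> / 2)
    \<le> (\<Sum>v\<le>d. \<Sum>v'\<le>d. (w v' - w v)\<^sup>2 * \<rho> \<bar>w v' - w v\<bar>)"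
proof -
  obtain M where M: "0 \<le> M" "variance d w \<le> M\<^sup>2" "M\<^sup>2 \<le> 4 * (real d + 1) * variance d w"
    "M\<^sup>2 * \<rho> M \<le> (\<Sum>v\<le>d. \<Sum>v'\<le>d. (w v' - w v)\<^sup>2 * \<rho> \<bar>w v' - w v\<bar>)"
    by (rule dissipation_ge_diameter[OF assms(1), of d w])
  have "1 \<le> M"
    using M(1,2) assms(5) power2_le_imp_le[of 1 M] by simp
  \<comment> \<open>The exponent is positive because \<alpha> < 2, so the power is monotone.\<close>
  have "variance d w powr (1 - \<alpha> / 2) \<le> (M\<^sup>2) powr (1 - \<alpha> / 2)"
    using assms M by (intro powr_mono2) auto
  also have "\<dots> = M\<^sup>2 * M powr (- \<alpha>)"
    using \<open>1 \<le> M\<close> by (simp add: powr_powr powr_diff powr_minus_divide flip: powr_numeral)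
  finally have "c * variance d w powr (1 - \<alpha> / 2) \<le> c * (M\<^sup>2 * M powr (- \<alpha>))"
    using assms(3) by simp
  also have "\<dots> = M\<^sup>2 * (c * M powr (- \<alpha>))"
    by simp
  also have "\<dots> \<le> M\<^sup>2 * \<rho> M"
    using assms(2) \<open>1 \<le> M\<close> by (intro mult_left_mono) auto
  finally show ?thesis
    using M(4) by linarith
qed

lemma dissipation_ge_variance:
  fixes w :: "nat \<Rightarrow> real"
  assumes "\<rho> ` {0..} \<subseteq> {0..1}" and "antimono_on {0..} \<rho>"
    and "variance d w < 1"
  shows "\<rho> (2 * (real d + 1)) * variance d w
    \<le> (\<Sum>v\<le>d. \<Sum>v'\<le>d. (w v' - w v)\<^sup>2 * \<rho> \<bar>w v' - w v\<bar>)"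
proof -
  obtain M where M: "0 \<le> M" "variance d w \<le> M\<^sup>2" "M\<^sup>2 \<le> 4 * (real d + 1) * variance d w"
    "M\<^sup>2 * \<rho> M \<le> (\<Sum>v\<le>d. \<Sum>v'\<le>d. (w v' - w v)\<^sup>2 * \<rho> \<bar>w v' - w v\<bar>)"
    by (rule dissipation_ge_diameter[OF assms(1), of d w])
  have "M\<^sup>2 \<le> 4 * (real d + 1) * 1"
    using M(3) assms(3) by (elim order_trans) (intro mult_left_mono, auto)
  \<comment> \<open>A cruder bound that avoids a square root: \<open>M\<close> stays below a number
    depending only on \<open>d\<close>, where monotonicity bounds \<open>\<rho> M\<close> from
    below.\<close>
  also have "\<dots> \<le> (2 * (real d + 1))\<^sup>2"
    by (simp add: power2_eq_square algebra_simps)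
  finally have "M \<le> 2 * (real d + 1)"
    by (rule power2_le_imp_le) simp
  then have "\<rho> (2 * (real d + 1)) \<le> \<rho> M"
    using assms(2) M(1) by (auto intro: monotone_onD)
  moreover have "0 \<le> \<rho> (2 * (real d + 1))"
    using assms(1) by (auto simp: image_subset_iff)
  ultimately have "variance d w * \<rho> (2 * (real d + 1)) \<le> M\<^sup>2 * \<rho> M"
    using M(2) by (intro mult_mono) auto
  then show ?thesis
    using M(4) by (simp add: mult.commute)
qed

theorem theorem10p11:
  fixes d :: nat and c \<alpha> :: real
  assumes "d \<ge> 1" and "c > 0" and "0 < \<alpha>" and "\<alpha> < 2"
  shows "\<exists>C>0. \<forall>(\<rho> :: real \<Rightarrow> real) (J :: real set) (u :: nat \<Rightarrow> real \<Rightarrow> real).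
           \<rho> ` {0..} \<subseteq> {0..1} \<longrightarrow>
           antimono_on {0..} \<rho> \<longrightarrow>
           (\<forall>s\<ge>1. \<rho> s \<ge> c * s powr (- \<alpha>)) \<longrightarrow>
           is_interval J \<longrightarrow>
           solution_on d \<rho> J u \<longrightarrow>
           (\<forall>t\<in>J.
              (1 \<le> variance d (\<lambda>v. u v t) \<longrightarrow>
                (\<exists>D. ((\<lambda>s. variance d (\<lambda>v. u v s) powr (\<alpha> / 2)) has_real_derivative D)
                       (at t within J) \<and> D \<le> - C)) \<and>
              (0 < variance d (\<lambda>v. u v t) \<and> variance d (\<lambda>v. u v t) < 1 \<longrightarrow>
                (\<exists>D. ((\<lambda>s. ln (variance d (\<lambda>v. u v s))) has_real_derivative D)
                       (at t within J) \<and> D \<le> - C)))"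
proof -
  define N where "N = (real d + 1) * real d"
  have "N > 0"
    using assms(1) by (simp add: N_def)
  \<comment> \<open>With \<open>E\<close> the double sum, \<open>Var' = - E / N\<close>.
    \<open>C1\<close> is the chain rule factor \<open>\<alpha> / 2\<close> times
    \<open>c / N\<close>; \<open>C2\<close> is the assumed lower bound for \<rho> at
    \<open>2 * (real d + 1)\<close>, divided by \<open>N\<close>.\<close>
  define C1 where "C1 = \<alpha> / 2 * c / N"
  define C2 where "C2 = c * (2 * (real d + 1)) powr (- \<alpha>) / N"
  have "C1 > 0" "C2 > 0"
    using \<open>N > 0\<close> assms by (auto simp: C1_def C2_def)
  show ?thesis
  proof (rule exI[of _ "min C1 C2"], rule conjI, goal_cases)
    case 1
    show ?case
      using \<open>C1 > 0\<close> \<open>C2 > 0\<close> by simp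
  next
    case 2
    show ?case
    proof (intro allI impI ballI)
      fix \<rho> :: "real \<Rightarrow> real" and J :: "real set" and u :: "nat \<Rightarrow> real \<Rightarrow> real" and t
      assume \<rho>: "\<rho> ` {0..} \<subseteq> {0..1}" "antimono_on {0..} \<rho>" "\<forall>s\<ge>1. \<rho> s \<ge> c * s powr (- \<alpha>)"
        and sol: "solution_on d \<rho> J u" "t \<in> J"
      define V where "V s = variance d (\<lambda>v. u v s)" for s
      define E where "E = (\<Sum>v\<le>d. \<Sum>v'\<le>d. (u v' t - u v t)\<^sup>2 * \<rho> \<bar>u v' t - u v t\<bar>)"
      have D: "(V has_real_derivative - (E / N)) (at t within J)"
        using solution_on_variance[OF sol] by (simp add: V_def[abs_def] E_def N_def)
      have "\<exists>D. ((\<lambda>s. V s powr (\<alpha> / 2)) has_real_derivative D) (at t within J) \<and> D \<le> - min C1 C2"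
        if "1 \<le> V t"
      proof (intro exI conjI)
        have "V t > 0"
          using that by simp
        show "((\<lambda>s. V s powr (\<alpha> / 2)) has_real_derivative
            \<alpha> / 2 * V t powr (\<alpha> / 2 - 1) * - (E / N)) (at t within J)"
          by (rule DERIV_chain2[OF has_real_derivative_powr[OF \<open>V t > 0\<close>] D])
        \<comment> \<open>The power \<alpha>/2 of the variance is chosen for this: the chain rule
          factor exactly cancels the variance in the lower bound for \<open>E\<close>.\<close>
        have "V t powr (\<alpha> / 2 - 1) * (c * V t powr (1 - \<alpha> / 2)) = c"
          using \<open>V t > 0\<close> by (simp flip: powr_add)
        moreover have "c * V t powr (1 - \<alpha> / 2) \<le> E"
          using dissipation_ge_variance_powr[OF \<rho>(1,3) assms(2,4)] that by (simp add: V_def E_def)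
        ultimately have "c \<le> V t powr (\<alpha> / 2 - 1) * E"
          by (metis mult_left_mono powr_ge_zero)
        then have "\<alpha> / 2 / N * c \<le> \<alpha> / 2 / N * (V t powr (\<alpha> / 2 - 1) * E)"
          using \<open>N > 0\<close> assms(3) by (intro mult_left_mono) auto
        then show "\<alpha> / 2 * V t powr (\<alpha> / 2 - 1) * - (E / N) \<le> - min C1 C2"
          by (simp add: C1_def min_le_iff_disj)
      qed
      moreover have "\<exists>D. ((\<lambda>s. ln (V s)) has_real_derivative D) (at t within J) \<and> D \<le> - min C1 C2"
        if "0 < V t" "V t < 1"
      proof (intro exI conjI)
        show "((\<lambda>s. ln (V s)) has_real_derivative 1 / V t * - (E / N)) (at t within J)"
          by (rule DERIV_chain2[OF DERIV_ln_divide[OF \<open>0 < V t\<close>] D])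
        \<comment> \<open>For small variance the bound on \<open>E\<close> is linear in
          \<open>V t\<close>, so dividing by \<open>V t\<close> leaves a constant. The decay
          assumption on \<rho> applies since \<open>2 * (real d + 1)\<close> is at least 1.\<close>
        have "\<rho> (2 * (real d + 1)) * V t \<le> E"
          using dissipation_ge_variance[OF \<rho>(1,2)] that by (simp add: V_def E_def)
        moreover have "c * (2 * (real d + 1)) powr (- \<alpha>) \<le> \<rho> (2 * (real d + 1))"
          using \<rho>(3) by simp
        ultimately have "c * (2 * (real d + 1)) powr (- \<alpha>) * V t \<le> E"
          using \<open>0 < V t\<close> by (meson mult_right_mono less_imp_le order_trans)
        then have "C2 \<le> 1 / V t * (E / N)"
          using \<open>0 < V t\<close> \<open>N > 0\<close> by (simp add: C2_def field_simps)
        then show "1 / V t * - (E / N) \<le> - min C1 C2"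
          by simp
      qed
      ultimately show "(1 \<le> variance d (\<lambda>v. u v t) \<longrightarrow>
            (\<exists>D. ((\<lambda>s. variance d (\<lambda>v. u v s) powr (\<alpha> / 2)) has_real_derivative D)
              (at t within J) \<and> D \<le> - min C1 C2)) \<and>
          (0 < variance d (\<lambda>v. u v t) \<and> variance d (\<lambda>v. u v t) < 1 \<longrightarrow>
            (\<exists>D. ((\<lambda>s. ln (variance d (\<lambda>v. u v s))) has_real_derivative D)
              (at t within J) \<and> D \<le> - min C1 C2))"
        unfolding V_def by blast
    qed
  qed
qed

end
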